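(* The ERI space $X=(X_0,\tau_{\mathrm{ERI}})$ is path-connected.
   Context: Let $\overline{\mathbb{R}}=[-\infty,+\infty]$ be the extended real line with its order topology. Let $\sim$ be the equivalence relation on $\overline{\mathbb{R}}$ whose only non-singleton class is $\{-\infty,0,+\infty\}$, let $X_0=\overline{\mathbb{R}}/{\sim}$ be the quotient set, $q\colon\overline{\mathbb{R}}\to X_0$ the projection, and $\ast=q(-\infty)=q(0)=q(+\infty)$. The ERI topology $\tau_{\mathrm{ERI}}$ on $X_0$ consists of all $U\subseteq X_0$ such that (a) $q^{-1}(U)$ is open in $\overline{\mathbb{R}}$, and (b) if $\ast\in U$ then $q^{-1}(U)$ is dense in $\overline{\mathbb{R}}$. (This is a topology.) The ERI space is $X=(X_0,\tau_{\mathrm{ERI}})$. Path-connected means that any two points are joined by a continuous map from $[0,1]$. *)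

theory Defs
  imports "HOL-Analysis.Analysis"
begin

definition eri_rel :: "(ereal \<times> ereal) set" where
  "eri_rel = {(x, y). x = y \<or> (x \<in> {-\<infinity>, 0, \<infinity>} \<and> y \<in> {-\<infinity>, 0, \<infinity>})}"

definition eri_carrier :: "ereal set set" where
  "eri_carrier = UNIV // eri_rel"

definition eri_proj :: "ereal \<Rightarrow> ereal set" where
  "eri_proj x = eri_rel `` {x}"

definition eri_star :: "ereal set" where
  "eri_star = eri_proj 0"

definition eri_open :: "ereal set set \<Rightarrow> bool" where
  "eri_open U \<longleftrightarrow> U \<subseteq> eri_carrier \<and> open (eri_proj -` U) \<and>
     (eri_star \<in> U \<longrightarrow> closure (eri_proj -` U) = UNIV)"

definition eri_space :: "ereal set topology" where
  "eri_space = topology eri_open"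

lemma equiv_eri_rel: "equiv UNIV eri_rel"
  by (auto simp: equiv_def refl_on_def sym_def trans_def eri_rel_def)

lemma eri_proj_eq_iff: "eri_proj x = eri_proj y \<longleftrightarrow> (x, y) \<in> eri_rel"
  unfolding eri_proj_def using equiv_eri_rel by (simp add: eq_equiv_class_iff)

lemma eri_star_eq: "eri_proj (-\<infinity>) = eri_star" "eri_proj \<infinity> = eri_star"
  by (simp_all add: eri_star_def eri_proj_eq_iff eri_rel_def)

lemma range_eri_proj: "range eri_proj = eri_carrier"
  by (auto simp: eri_proj_def eri_carrier_def quotient_def)

lemma istopology_eri_open: "istopology eri_open"
  unfolding istopology_def
proof (intro conjI allI impI)
  fix S T assume S: "eri_open S" and T: "eri_open T"
  have "closure (eri_proj -` (S \<inter> T)) = UNIV" if "eri_star \<in> S \<inter> T"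
  proof -
    have "open (eri_proj -` S)" "closure (eri_proj -` S) = UNIV" "closure (eri_proj -` T) = UNIV"
      using S T that by (auto simp: eri_open_def)
    then have "closure (eri_proj -` S \<inter> eri_proj -` T) = UNIV"
      using open_Int_closure_subset[of "eri_proj -` S" "eri_proj -` T"]
        closure_minimal[of "eri_proj -` S" "closure (eri_proj -` S \<inter> eri_proj -` T)"]
      by auto
    then show ?thesis by (simp add: vimage_Int)
  qed
  then show "eri_open (S \<inter> T)"
    using S T by (auto simp: eri_open_def vimage_Int)
next
  fix K assume K: "\<forall>S\<in>K. eri_open S"
  have "closure (eri_proj -` \<Union>K) = UNIV" if star: "eri_star \<in> \<Union>K"
  proof -
    obtain S where S: "S \<in> K" "eri_star \<in> S" using star by blast
    then have "closure (eri_proj -` S) = UNIV" using K by (simp add: eri_open_def)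
    moreover have "closure (eri_proj -` S) \<subseteq> closure (eri_proj -` \<Union>K)"
      using S by (intro closure_mono) auto
    ultimately show ?thesis by auto
  qed
  moreover have "open (eri_proj -` \<Union>K)"
    using K by (auto simp: eri_open_def vimage_Union)
  ultimately show "eri_open (\<Union>K)"
    using K by (auto simp: eri_open_def)
qed

lemma openin_eri_space: "openin eri_space U \<longleftrightarrow> eri_open U"
  by (simp add: eri_space_def istopology_eri_open)

lemma topspace_eri_space: "topspace eri_space = eri_carrier"
proof -
  have "eri_proj -` eri_carrier = UNIV"
    using range_eri_proj by auto
  then have "eri_open eri_carrier"
    by (simp add: eri_open_def)
  then show ?thesis
    unfolding topspace_def openin_eri_space by (auto simp: eri_open_def)
qed

end

(* Every class has a real representative, since both infinities are identified with 0.
   By condition (a), the projection is continuous, so the space is a continuous image of the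
   real line; the density condition (b) only removes open sets. *)
theory Submission
  imports Defs
begin

lemma range_eri_proj_ereal: "range (\<lambda>r. eri_proj (ereal r)) = eri_carrier"
proof -
  have "eri_proj x \<in> range (\<lambda>r. eri_proj (ereal r))" for x
    \<comment> \<open>At both infinities the real representative is 0: their class is
      \<open>eri_star\<close>, and \<open>zero_ereal_def\<close> exhibits 0 as
      \<open>ereal 0\<close>.\<close>
    by (cases x) (auto simp: eri_star_eq eri_star_def zero_ereal_def)
  then show ?thesis
    unfolding range_eri_proj[symmetric] by blast
qed

lemma continuous_map_eri_proj: "continuous_map euclidean eri_space eri_proj"
  using range_eri_proj
  by (auto simp: continuous_map_def topspace_eri_space openin_eri_space eri_open_def vimage_def)

theorem proposition2p16: "path_connected_space eri_space"
proof -
  have "continuous_map euclidean euclidean ereal"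
    by (simp add: continuous_on_ereal continuous_on_id)
  then have "continuous_map euclidean eri_space (eri_proj \<circ> ereal)"
    using continuous_map_eri_proj by (rule continuous_map_compose)
  \<comment> \<open>The real line is path-connected because it is convex; \<open>ereal\<close> is no
    vector space, hence the detour through \<open>ereal\<close> as a map.\<close>
  moreover have "path_connectedin euclidean (UNIV :: real set)"
    by simp
  ultimately have "path_connectedin eri_space (range (eri_proj \<circ> ereal))"
    by (rule path_connectedin_continuous_map_image)
  \<comment> \<open>By surjectivity the image is the whole carrier, which the flipped equation
    rewrites to the topspace.\<close>
  then show ?thesis
    using range_eri_proj_ereal
    by (simp add: comp_def path_connectedin_topspace flip: topspace_eri_space)
qed

end
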